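(* Let $\alpha>0$ with $\alpha\neq 1$ and let $k^d,k^t\in\mathbb{N}$. There is an instance $I$ of the relief distribution problem with $k^t$ trucks, $k^d$ drones and drone speed $\alpha$ such that $$\frac{\mathrm{Optimistic}(I)}{\mathrm{OPT}(I^* )}=\min\{2,\,1+\alpha\}.$$
   Context: Relief distribution problem (RDP). $\mathbb{N}=\{1,2,\dots\}$. An instance is $I=(k^t,k^d,\alpha,G,D)$: $k^t,k^d\in\mathbb{N}$ are the numbers of trucks and drones; $\alpha>0$ is the drone speed; $G=(V,E,c)$ is a finite connected undirected graph (not necessarily complete) with $V=\{v_0\}\cup C$, where $v_0$ is the depot and $C\neq\emptyset$ is the set of non-depot nodes; edge lengths $c(i,j)>0$ satisfy the triangle inequality; $D\subseteq C$ is the set of damaged nodes, initially unknown; the status of a node is revealed when some vehicle first arrives at it. For non-adjacent $i,j$, $c(i,j)$ is the shortest-path distance. A truck needs time $c(i,j)$ to traverse an edge, a drone needs $\frac1\alpha c(i,j)$. A tour is a closed walk in $G$ starting and ending at $v_0$ (possibly of length $0$); it visits all nodes lying on it. The makespan of a family of tours is the maximum duration of a tour. Full-information optimum: $\mathrm{OPT}(I^* )$ is the minimum makespan over all families of $k^t$ truck tours and $k^d$ drone tours such that every node of $C$ is visited by some vehicle and every node of $D$ is visited by a truck ($I^*$ is the instance $I$ with $D$ known in advance). For integers $m,n\ge 0$ with $m+n\ge1$ and $W\subseteq C$, $\mathrm{TSP}_{m,n}(W)$ denotes the minimum makespan over all families of $m$ truck tours and $n$ drone tours that together visit all nodes of $W$,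 and $S^*_{m,n}(W)$ denotes an optimal such family. Policy Optimistic (deterministic; optimal families are selected by a fixed rule based only on the information available at that time, so the first-stage tours do not depend on $D$). First stage: the vehicles execute the tours of $S^*_{k^t,k^d}(C)$ and return to the depot. Let $D^d\subseteq D$ be the set of damaged nodes not visited by truck tours in this stage. Second stage (after all vehicles returned): the trucks execute $S^*_{k^t,0}(D^d)$. Its makespan is $\mathrm{Optimistic}(I)=\mathrm{TSP}_{k^t,k^d}(C)+\mathrm{TSP}_{k^t,0}(D^d)$. *)

theory Defs
  imports "Graph_Theory.Graph_Theory"
begin

section \<open>Instances\<close>

text \<open>
  A \<open>network\<close> is the part \<open>(k\<^sup>t, k\<^sup>d, \<alpha>, G)\<close> of an instance that is known from the start; the
  set \<open>D\<close> of damaged nodes is always passed as a separate argument. An undirected graph is a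
  symmetric \<open>pair_pre_digraph\<close>, i.e. an edge consists of the two arcs \<open>(u, v)\<close> and \<open>(v, u)\<close>.
\<close>

record 'v network =
  trucks :: nat
  drones :: nat
  speed :: real
  road :: "'v pair_pre_digraph"
  edge_length :: "'v \<times> 'v \<Rightarrow> real"
  depot :: 'v

definition customers :: "'v network \<Rightarrow> 'v set" where
  "customers N = pverts (road N) - {depot N}"

text \<open>Edge length on adjacent nodes, shortest-path distance on all other pairs.\<close>

definition distance :: "'v network \<Rightarrow> 'v \<Rightarrow> 'v \<Rightarrow> real" where
  "distance N i j =
     (if (i, j) \<in> parcs (road N) then edge_length N (i, j)
      else real_of_ereal (wf_digraph.\<mu> (with_proj (road N)) (edge_length N) i j))"

definition rdp_network :: "'v network \<Rightarrow> bool" where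
  "rdp_network N \<longleftrightarrow>
     1 \<le> trucks N \<and> 1 \<le> drones N \<and> 0 < speed N \<and>
     pair_graph (road N) \<and> Digraph_Component.connected (with_proj (road N)) \<and>
     depot N \<in> pverts (road N) \<and> customers N \<noteq> {} \<and>
     (\<forall>i j. (i, j) \<in> parcs (road N) \<longrightarrow>
        0 < edge_length N (i, j) \<and> edge_length N (i, j) = edge_length N (j, i)) \<and>
     (\<forall>i\<in>pverts (road N). \<forall>j\<in>pverts (road N). \<forall>k\<in>pverts (road N).
        distance N i k \<le> distance N i j + distance N j k)"

definition rdp_instance :: "'v network \<Rightarrow> 'v set \<Rightarrow> bool" where
  "rdp_instance N D \<longleftrightarrow> rdp_network N \<and> D \<subseteq> customers N"


section \<open>Families of tours\<close>

text \<open>Tours are lists of arcs; the empty list is the tour that stays at the depot.\<close>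

type_synonym 'v tour = "('v \<times> 'v) awalk"

text \<open>The truck tours and the drone tours.\<close>

type_synonym 'v family = "'v tour list \<times> 'v tour list"

definition is_tour :: "'v network \<Rightarrow> 'v tour \<Rightarrow> bool" where
  "is_tour N p \<longleftrightarrow> pre_digraph.awalk (with_proj (road N)) (depot N) p (depot N)"

definition visited :: "'v network \<Rightarrow> 'v tour list \<Rightarrow> 'v set" where
  "visited N ps =
     (\<Union>p\<in>set ps. set (pre_digraph.awalk_verts (with_proj (road N)) (depot N) p))"

definition families :: "'v network \<Rightarrow> nat \<Rightarrow> nat \<Rightarrow> 'v family set" where
  "families N m n =
     {(T, U). length T = m \<and> length U = n \<and> (\<forall>p\<in>set T \<union> set U. is_tour N p)}"

definition truck_time :: "'v network \<Rightarrow> 'v tour \<Rightarrow> real" where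
  "truck_time N p = wf_digraph.awalk_cost (edge_length N) p"

definition drone_time :: "'v network \<Rightarrow> 'v tour \<Rightarrow> real" where
  "drone_time N p = wf_digraph.awalk_cost (\<lambda>e. 1 / speed N * edge_length N e) p"

definition makespan :: "'v network \<Rightarrow> 'v family \<Rightarrow> real" where
  "makespan N F = Max (truck_time N ` set (fst F) \<union> drone_time N ` set (snd F))"

definition covering :: "'v network \<Rightarrow> nat \<Rightarrow> nat \<Rightarrow> 'v set \<Rightarrow> 'v family set" where
  "covering N m n W =
     {F \<in> families N m n. W \<subseteq> visited N (fst F) \<union> visited N (snd F)}"

text \<open>
  The infima in \<open>TSP\<close> and \<open>OPT\<close> are minima: see \<open>ex_optimal_family\<close>, \<open>TSP_attained\<close> and
  \<open>OPT_attained\<close>.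
\<close>

definition TSP :: "'v network \<Rightarrow> nat \<Rightarrow> nat \<Rightarrow> 'v set \<Rightarrow> real" where
  "TSP N m n W = Inf (makespan N ` covering N m n W)"

definition optimal_family :: "'v network \<Rightarrow> nat \<Rightarrow> nat \<Rightarrow> 'v set \<Rightarrow> 'v family \<Rightarrow> bool" where
  "optimal_family N m n W F \<longleftrightarrow> is_arg_min (makespan N) (\<lambda>F. F \<in> covering N m n W) F"

definition full_information :: "'v network \<Rightarrow> 'v set \<Rightarrow> 'v family set" where
  "full_information N D =
     {F \<in> families N (trucks N) (drones N).
        customers N \<subseteq> visited N (fst F) \<union> visited N (snd F) \<and> D \<subseteq> visited N (fst F)}"

definition OPT :: "'v network \<Rightarrow> 'v set \<Rightarrow> real" where
  "OPT N D = Inf (makespan N ` full_information N D)"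


section \<open>The policy Optimistic\<close>

text \<open>
  A rule for the first stage picks an optimal family from the network alone, so that its choice
  cannot depend on \<open>D\<close>. Which optimal family is picked in the second stage is irrelevant, because
  they all have makespan \<open>TSP\<close>.
\<close>

definition first_stage_rule :: "('v network \<Rightarrow> 'v family) \<Rightarrow> bool" where
  "first_stage_rule S \<longleftrightarrow>
     (\<forall>N. rdp_network N \<longrightarrow> optimal_family N (trucks N) (drones N) (customers N) (S N))"

definition missed_damaged :: "('v network \<Rightarrow> 'v family) \<Rightarrow> 'v network \<Rightarrow> 'v set \<Rightarrow> 'v set" where
  "missed_damaged S N D = D - visited N (fst (S N))"

definition Optimistic :: "('v network \<Rightarrow> 'v family) \<Rightarrow> 'v network \<Rightarrow> 'v set \<Rightarrow> real" where
  "Optimistic S N D =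
     TSP N (trucks N) (drones N) (customers N) + TSP N (trucks N) 0 (missed_damaged S N D)"


section \<open>Existence of optimal families\<close>

lemma truck_time_eq:
  assumes "rdp_network N" shows "truck_time N p = sum_list (map (edge_length N) p)"
proof -
  interpret pair_graph "road N" using assms by (simp add: rdp_network_def)
  show ?thesis by (simp add: truck_time_def awalk_cost_def)
qed

lemma drone_time_eq:
  assumes "rdp_network N" shows "drone_time N p = sum_list (map (edge_length N) p) / speed N"
proof -
  interpret pair_graph "road N" using assms by (simp add: rdp_network_def)
  show ?thesis
    unfolding drone_time_def awalk_cost_def by (induction p) (simp_all add: add_divide_distrib)
qed

lemma finite_short_tours:
  assumes N: "rdp_network N"
  shows "finite {p. is_tour N p \<and> sum_list (map (edge_length N) p) \<le> B}"
proof -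
  interpret pair_graph "road N" using N by (simp add: rdp_network_def)
  let ?A = "parcs (road N)"
  define d where "d = Min (insert 1 (edge_length N ` ?A))"
  have fin: "finite ?A" by simp
  have d: "d \<le> edge_length N e" if "e \<in> ?A" for e
    unfolding d_def using that by (intro Min_le) auto
  have d0: "0 < d"
    unfolding d_def using N by (subst Min_gr_iff) (auto simp: rdp_network_def)
  have len: "real (length p) * d \<le> sum_list (map (edge_length N) p)" if "set p \<subseteq> ?A" for p
    using that by (induction p) (use d in \<open>auto simp: algebra_simps intro: add_mono\<close>)
  have "{p. is_tour N p \<and> sum_list (map (edge_length N) p) \<le> B}
      \<subseteq> {p. set p \<subseteq> ?A \<and> length p \<le> nat \<lceil>B / d\<rceil>}"
  proof safe
    fix p a b assume "is_tour N p" "(a, b) \<in> set p"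
    then show "(a, b) \<in> ?A" by (auto simp: is_tour_def awalk_def)
  next
    fix p assume p: "is_tour N p" "sum_list (map (edge_length N) p) \<le> B"
    then have "set p \<subseteq> ?A" by (auto simp: is_tour_def awalk_def)
    from len[OF this] p d0 have "real (length p) \<le> B / d" by (simp add: field_simps)
    then show "length p \<le> nat \<lceil>B / d\<rceil>" by linarith
  qed
  then show ?thesis by (rule finite_subset) (rule finite_lists_length_le[OF fin])
qed

lemma ex_arg_min_makespan:
  assumes N: "rdp_network N" and sub: "X \<subseteq> families N m n" and ne: "X \<noteq> {}"
  shows "\<exists>F. is_arg_min (makespan N) (\<lambda>F. F \<in> X) F"
proof -
  obtain F0 where F0: "F0 \<in> X" using ne by blast
  define B where "B = makespan N F0"
  define P where "P = {p. is_tour N p \<and> sum_list (map (edge_length N) p) \<le> max B (B * speed N)}"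
  define Y where "Y = {F \<in> X. makespan N F \<le> B}"
  have sp: "0 < speed N" using N by (simp add: rdp_network_def)
  have "Y \<subseteq> {T. set T \<subseteq> P \<and> length T = m} \<times> {U. set U \<subseteq> P \<and> length U = n}"
  proof
    fix F assume "F \<in> Y"
    then have F: "F \<in> families N m n" "makespan N F \<le> B" using sub by (auto simp: Y_def)
    let ?M = "truck_time N ` set (fst F) \<union> drone_time N ` set (snd F)"
    have M: "x \<le> B" if "x \<in> ?M" for x
    proof -
      have "x \<le> Max ?M" using that by (intro Max_ge) simp_all
      then show ?thesis using F(2) by (simp add: makespan_def)
    qed
    have tours: "is_tour N p" if "p \<in> set (fst F) \<union> set (snd F)" for p
      using F(1) that by (auto simp: families_def)
    have "p \<in> P" if "p \<in> set (fst F)" for p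
      using tours[of p] M[of "truck_time N p"] that by (auto simp: P_def truck_time_eq[OF N])
    moreover have "p \<in> P" if "p \<in> set (snd F)" for p
    proof -
      have "drone_time N p \<le> B" using that by (intro M) simp
      then have "sum_list (map (edge_length N) p) \<le> B * speed N"
        using sp by (simp add: drone_time_eq[OF N] pos_divide_le_eq)
      then show ?thesis using tours[of p] that by (simp add: P_def)
    qed
    moreover have "length (fst F) = m" "length (snd F) = n"
      using F(1) by (auto simp: families_def)
    ultimately show "F \<in> {T. set T \<subseteq> P \<and> length T = m} \<times> {U. set U \<subseteq> P \<and> length U = n}"
      by (cases F) auto
  qed
  moreover have "finite P" unfolding P_def by (rule finite_short_tours[OF N])
  ultimately have "finite Y"
    by (elim finite_subset) (intro finite_cartesian_product finite_lists_length_eq)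
  moreover have Y: "F0 \<in> Y" using F0 by (simp add: Y_def B_def)
  ultimately have "\<exists>F. is_arg_min (makespan N) (\<lambda>F. F \<in> Y) F"
    by (intro ex_is_arg_min_if_finite) auto
  then obtain F where F: "F \<in> Y" "\<And>G. G \<in> Y \<Longrightarrow> makespan N F \<le> makespan N G"
    by (auto simp: is_arg_min_linorder)
  have "makespan N F \<le> makespan N G" if "G \<in> X" for G
  proof (cases "makespan N G \<le> B")
    case True
    then show ?thesis using F(2) that by (simp add: Y_def)
  next
    case False
    then show ?thesis using F(1) by (simp add: Y_def)
  qed
  then have "is_arg_min (makespan N) (\<lambda>F. F \<in> X) F"
    using F(1) by (simp add: is_arg_min_linorder Y_def)
  then show ?thesis ..
qed

lemma ex_tour_through_all:
  assumes N: "rdp_network N"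
  shows "\<exists>p. is_tour N p \<and> customers N \<subseteq> visited N [p]"
proof -
  interpret pair_graph "road N" using N by (simp add: rdp_network_def)
  let ?G = "with_proj (road N)"
  have dep: "depot N \<in> pverts (road N)" using N by (simp add: rdp_network_def)
  have reach: "\<exists>p. awalk u p v" if "u \<in> pverts (road N)" "v \<in> pverts (road N)" for u v
  proof -
    have "strongly_connected ?G"
      using N pair_sym_arcs symmetric_connected_imp_strongly_connected
      by (simp add: rdp_network_def)
    then have "u \<rightarrow>\<^sup>*\<^bsub>?G\<^esub> v" using that by (auto simp: strongly_connected_def)
    then show ?thesis using reachable_awalk by simp
  qed
  have "\<exists>p. is_tour N p \<and> W \<subseteq> visited N [p]" if "finite W" "W \<subseteq> pverts (road N)" for W
    using that
  proof (induction W rule: finite_induct)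
    case empty
    then show ?case using dep by (intro exI[of _ "[]"]) (simp add: is_tour_def awalk_Nil_iff)
  next
    case (insert w W)
    then obtain p where p: "is_tour N p" "W \<subseteq> visited N [p]" by auto
    have w: "w \<in> pverts (road N)" using insert.prems by simp
    obtain q r where qr: "awalk (depot N) q w" "awalk w r (depot N)"
      using reach[OF dep w] reach[OF w dep] by auto
    have p': "awalk (depot N) p (depot N)" using p by (simp add: is_tour_def)
    have c: "awalk (depot N) (q @ r) (depot N)" using qr by (rule awalk_appendI)
    have wr: "w \<in> set (awalk_verts w r)"
      by (cases r) (use qr(2) in \<open>auto simp: awalk_Cons_iff\<close>)
    have "is_tour N (p @ q @ r)"
      unfolding is_tour_def using p' c by (rule awalk_appendI)
    moreover have "set (awalk_verts (depot N) (p @ q @ r)) =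
        set (awalk_verts (depot N) p) \<union> set (awalk_verts (depot N) (q @ r))"
      using set_awalk_verts_append[OF p' c] by simp
    moreover have "w \<in> set (awalk_verts (depot N) (q @ r))"
      using set_awalk_verts_append[OF qr] wr by simp
    ultimately show ?case using p(2) by (intro exI[of _ "p @ q @ r"]) (auto simp: visited_def)
  qed
  from this[of "customers N"] show ?thesis by (simp add: customers_def)
qed

lemma Inf_arg_min:
  fixes f :: "'b \<Rightarrow> real"
  assumes "is_arg_min f (\<lambda>F. F \<in> X) F" shows "Inf (f ` X) = f F"
proof (rule cInf_eq_minimum)
  show "f F \<in> f ` X" using assms by (simp add: is_arg_min_def)
  show "f F \<le> y" if "y \<in> f ` X" for y using assms that by (auto simp: is_arg_min_linorder)
qed

lemma ex_optimal_family:
  assumes N: "rdp_network N" and W: "W \<subseteq> customers N" and mn: "1 \<le> m + n"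
  shows "\<exists>F. optimal_family N m n W F"
proof -
  obtain p where p: "is_tour N p" "customers N \<subseteq> visited N [p]"
    using ex_tour_through_all[OF N] by blast
  have "(replicate m p, replicate n p) \<in> covering N m n W"
    using p W mn by (cases m; cases n) (auto simp: covering_def families_def visited_def)
  then show ?thesis
    unfolding optimal_family_def
    using ex_arg_min_makespan[OF N, of "covering N m n W" m n] by (auto simp: covering_def)
qed

lemma TSP_attained:
  assumes "optimal_family N m n W F" shows "TSP N m n W = makespan N F"
  unfolding TSP_def by (rule Inf_arg_min) (use assms in \<open>simp add: optimal_family_def\<close>)

lemma ex_first_stage_rule: "\<exists>S. first_stage_rule S"
proof -
  have "optimal_family N (trucks N) (drones N) (customers N)
      (SOME F. optimal_family N (trucks N) (drones N) (customers N) F)"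
    if "rdp_network N" for N :: "'a network"
    by (rule someI_ex, rule ex_optimal_family) (use that in \<open>auto simp: rdp_network_def\<close>)
  then show ?thesis unfolding first_stage_rule_def
    by (intro exI[of _ "\<lambda>N. SOME F. optimal_family N (trucks N) (drones N) (customers N) F"]) blast
qed

lemma OPT_attained:
  assumes I: "rdp_instance N D"
  shows "\<exists>F. is_arg_min (makespan N) (\<lambda>F. F \<in> full_information N D) F \<and> OPT N D = makespan N F"
proof -
  have N: "rdp_network N" and D: "D \<subseteq> customers N" using I by (auto simp: rdp_instance_def)
  obtain p where p: "is_tour N p" "customers N \<subseteq> visited N [p]"
    using ex_tour_through_all[OF N] by blast
  have "trucks N \<noteq> 0" using N by (simp add: rdp_network_def)
  then have "(replicate (trucks N) p, replicate (drones N) p) \<in> full_information N D"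
    using p D by (auto simp: full_information_def families_def visited_def)
  then obtain F where F: "is_arg_min (makespan N) (\<lambda>F. F \<in> full_information N D) F"
    using ex_arg_min_makespan[OF N, of "full_information N D" "trucks N" "drones N"]
    by (auto simp: full_information_def)
  show ?thesis using F Inf_arg_min[OF F] by (intro exI[of _ F]) (simp add: OPT_def)
qed

end

theory Submission
  imports Defs
begin

text \<open>
  Take a star around the depot in which every customer is at distance \<open>1 / 2\<close>, so that serving \<open>k\<close>
  customers takes a truck time \<open>k\<close> and a drone time \<open>k / \<alpha>\<close>. Let \<open>M = max 1 (1 / \<alpha>)\<close> be the time
  in which the slower kind of vehicle serves exactly one customer, and let the number of customers
  be the number that all vehicles together can serve in time \<open>M\<close>. In less than time \<open>M\<close> the slower
  vehicles serve nobody, so the first stage takes time exactly \<open>M\<close> and leaves some customer unserved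
  by the trucks. If this is the only damaged customer, the second stage takes time \<open>1\<close>, whereas by
  symmetry of the star the full-information optimum is still \<open>M\<close>. The ratio is
  \<open>(M + 1) / M = 1 + min 1 \<alpha>\<close>.
\<close>

section \<open>Stars\<close>

definition star_graph :: "nat \<Rightarrow> nat pair_pre_digraph" where
  "star_graph n = \<lparr>pverts = {0..n}, parcs = {0} \<times> {1..n} \<union> {1..n} \<times> {0}\<rparr>"

definition star_network :: "nat \<Rightarrow> nat \<Rightarrow> real \<Rightarrow> nat \<Rightarrow> nat network" where
  "star_network k l \<alpha> n =
     \<lparr>trucks = k, drones = l, speed = \<alpha>, road = star_graph n,
      edge_length = (\<lambda>_. 1 / 2), depot = 0\<rparr>"

lemma star_graph_simps [simp]:
  "pverts (star_graph n) = {0..n}"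
  "parcs (star_graph n) = {0} \<times> {1..n} \<union> {1..n} \<times> {0}"
  by (simp_all add: star_graph_def)

lemma star_network_simps [simp]:
  "trucks (star_network k l \<alpha> n) = k"
  "drones (star_network k l \<alpha> n) = l"
  "speed (star_network k l \<alpha> n) = \<alpha>"
  "road (star_network k l \<alpha> n) = star_graph n"
  "edge_length (star_network k l \<alpha> n) = (\<lambda>_. 1 / 2)"
  "depot (star_network k l \<alpha> n) = 0"
  by (simp_all add: star_network_def)

interpretation star: pair_graph "star_graph n" for n
  by unfold_locales (auto simp: symmetric_def intro!: symI)

lemma customers_star [simp]: "customers (star_network k l \<alpha> n) = {1..n}"
  by (auto simp: customers_def)

lemma star_awalk_cost [simp]: "star.awalk_cost (\<lambda>_. c) p = real (length p) * c"
  by (induction p) (simp_all add: algebra_simps)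

text \<open>The conditionals drop a leg at an end that is the depot itself. This route yields
  connectivity as well as the upper bound on distances.\<close>

lemma star_awalk_via_depot:
  assumes "i \<le> n" "j \<le> n"
  shows "star.awalk n i ((if i = 0 then [] else [(i, 0)]) @ (if j = 0 then [] else [(0, j)])) j"
  using assms by (auto simp: star.awalk_def)

lemma connected_star: "Digraph_Component.connected (with_proj (star_graph n))"
proof -
  have "u \<rightarrow>\<^sup>*\<^bsub>with_proj (star_graph n)\<^esub> v" if "u \<le> n" "v \<le> n" for u v
    using star_awalk_via_depot[OF that] star.reachable_awalk by blast
  then show ?thesis
    unfolding Digraph_Component.connected_def
    by (intro strongly_connectedI) (simp_all add: star.reachable_mk_symmetric_eq[OF star.pair_sym_arcs])
qed

text \<open>Two customers are never adjacent, so a walk between distinct ones needs a second arc; if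
  one end is the depot, the walk only has to be non-empty.\<close>

lemma star_awalk_length:
  assumes "star.awalk n i p j" "i \<noteq> j"
  shows "of_bool (i \<noteq> 0) + of_bool (j \<noteq> 0) \<le> length p"
  using assms by (cases p; cases "tl p") (auto simp: star.awalk_def)

text \<open>For distinct nodes, each end that is a customer contributes its distance 1 / 2 to the
  depot. In this form the triangle inequality demanded by \<open>rdp_network\<close> is plain
  arithmetic.\<close>

lemma distance_star:
  assumes "i \<le> n" "j \<le> n"
  shows "distance (star_network k l \<alpha> n) i j =
    (if i = j then 0 else (of_bool (i \<noteq> 0) + of_bool (j \<noteq> 0)) / 2)"
proof (cases "(i, j) \<in> parcs (star_graph n)")
  case True
  then show ?thesis by (auto simp: distance_def)
next
  case False
  let ?d = "if i = j then 0 else (of_bool (i \<noteq> 0) + of_bool (j \<noteq> 0)) / 2 :: real"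
  have "star.\<mu> n (\<lambda>_. 1 / 2) i j = ereal ?d"
    unfolding star.\<mu>_def
  proof (rule antisym)
    \<comment> \<open>Equal ends need the empty walk: from a customer back to itself, the route via
      the depot is a detour of length 1.\<close>
    let ?p = "if i = j then [] else (if i = 0 then [] else [(i, 0)]) @ (if j = 0 then [] else [(0, j)])"
    have "star.awalk n i ?p j"
      using star_awalk_via_depot[OF assms] assms by (simp add: star.awalk_Nil_iff)
    then show "(INF p\<in>{p. star.awalk n i p j}. ereal (star.awalk_cost (\<lambda>_. 1 / 2) p)) \<le> ereal ?d"
      by (intro INF_lower2[of ?p]) (auto)
  next
    show "ereal ?d \<le> (INF p\<in>{p. star.awalk n i p j}. ereal (star.awalk_cost (\<lambda>_. 1 / 2) p))"
    proof (rule INF_greatest)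
      fix p assume "p \<in> {p. star.awalk n i p j}"
      then have "of_bool (i \<noteq> 0) + of_bool (j \<noteq> 0) \<le> real (length p)" if "i \<noteq> j"
        using star_awalk_length[of n i p j] that by (simp flip: of_nat_le_iff[where 'a = real])
      then show "ereal ?d \<le> ereal (star.awalk_cost (\<lambda>_. 1 / 2) p)" by auto
    qed
  qed
  then show ?thesis using False by (auto simp: distance_def)
qed

lemma rdp_network_star:
  assumes "1 \<le> k" "1 \<le> l" "0 < \<alpha>" "1 \<le> n"
  shows "rdp_network (star_network k l \<alpha> n)"
  using assms connected_star[of n] star.pair_graph[of n]
  by (auto simp: rdp_network_def distance_star)

section \<open>Tours in stars\<close>

lemma truck_time_star: "truck_time (star_network k l \<alpha> n) p = real (length p) / 2"
  by (simp add: truck_time_def)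

lemma drone_time_star: "drone_time (star_network k l \<alpha> n) p = real (length p) / 2 / \<alpha>"
  by (simp add: drone_time_def)

text \<open>The depot is the only neighbour of a customer, so the tour uses both arcs between the
  depot and each customer visited, and all these arcs are distinct.\<close>

lemma tour_visits_at_most:
  assumes "is_tour (star_network k l \<alpha> n) p"
  shows "2 * card (visited (star_network k l \<alpha> n) [p] - {0}) \<le> length p"
proof -
  let ?V = "visited (star_network k l \<alpha> n) [p] - {0}"
  have p: "star.awalk n 0 p 0" using assms by (simp add: is_tour_def)
  have arcs: "(0, v) \<in> set p \<and> (v, 0) \<in> set p" if "v \<in> ?V" for v
  proof -
    have v: "v \<noteq> 0" "v \<in> set (pawalk_verts 0 p)" using that by (auto simp: visited_def)
    \<comment> \<open>Splitting at \<open>v\<close> leaves two non-empty walks: the first must enter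
      \<open>v\<close> from the depot, the second must leave \<open>v\<close> towards it.\<close>
    then obtain q r where qr: "p = q @ r" "star.awalk n 0 q v" "star.awalk n v r 0"
      using star.awalk_decomp[OF p] by blast
    have "(0, v) \<in> set q"
      using qr(2) v(1) by (cases q rule: rev_cases) (auto simp: star.awalk_def)
    moreover have "(v, 0) \<in> set r"
      using qr(3) v(1) by (cases r) (auto simp: star.awalk_def)
    ultimately show ?thesis using qr(1) by simp
  qed
  have fin: "finite ?V" by (simp add: visited_def)
  have "card ({0 :: nat} \<times> ?V \<union> ?V \<times> {0 :: nat}) = card ({0 :: nat} \<times> ?V) + card (?V \<times> {0 :: nat})"
    by (intro card_Un_disjoint) (use fin in auto)
  also have "\<dots> = 2 * card ?V" by (simp add: card_cartesian_product)
  finally have "2 * card ?V = card ({0 :: nat} \<times> ?V \<union> ?V \<times> {0 :: nat})" ..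
  also have "\<dots> \<le> card (set p)" using arcs by (intro card_mono) (simp, blast)
  also have "\<dots> \<le> length p" by (rule card_length)
  finally show ?thesis .
qed

section \<open>Capacity bounds for families of tours\<close>

lemma card_UN_list_le:
  assumes "\<And>x. x \<in> set xs \<Longrightarrow> card (f x) \<le> c"
  shows "card (\<Union>x\<in>set xs. f x) \<le> length xs * c"
  using assms
proof (induction xs)
  case (Cons x xs)
  have "card (\<Union>y\<in>set (x # xs). f y) \<le> card (f x) + card (\<Union>y\<in>set xs. f y)"
    using card_Un_le by simp
  also have "\<dots> \<le> c + length xs * c" using Cons by (intro add_mono) auto
  finally show ?case by simp
qed simp

text \<open>Without any vehicle the makespan would be \<open>Max\<close> of the empty set, which is
  unspecified.\<close>

lemma makespan_le_iff:
  assumes "fst F \<noteq> [] \<or> snd F \<noteq> []"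
  shows "makespan N F \<le> B \<longleftrightarrow>
    (\<forall>p\<in>set (fst F). truck_time N p \<le> B) \<and> (\<forall>p\<in>set (snd F). drone_time N p \<le> B)"
  using assms unfolding makespan_def by (subst Max_le_iff) auto

text \<open>With edges of length 1 / 2, serving \<open>c\<close> customers costs at least truck time
  \<open>c\<close> or drone time \<open>c / \<alpha>\<close>. As \<open>c\<close> is an integer, the
  bounds can be rounded down.\<close>

lemma family_visits_at_most:
  fixes k l \<alpha> n
  defines "N \<equiv> star_network k l \<alpha> n"
  assumes F: "F \<in> families N m h" and B: "makespan N F \<le> B" and mh: "1 \<le> m + h" and \<alpha>: "0 < \<alpha>"
  shows "card (visited N (fst F) - {0}) \<le> m * nat \<lfloor>B\<rfloor>"
    and "card (visited N (snd F) - {0}) \<le> h * nat \<lfloor>\<alpha> * B\<rfloor>"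
proof -
  have tour: "is_tour N p" if "p \<in> set (fst F) \<union> set (snd F)" for p
    using F that by (auto simp: families_def)
  have len: "length (fst F) = m" "length (snd F) = h"
    using F by (auto simp: families_def)
  then have "fst F \<noteq> [] \<or> snd F \<noteq> []" using mh by auto
  then have time: "p \<in> set (fst F) \<Longrightarrow> truck_time N p \<le> B"
    "p \<in> set (snd F) \<Longrightarrow> drone_time N p \<le> B" for p
    using B by (auto simp: makespan_le_iff)
  have eq: "visited N ps - {0} = (\<Union>p\<in>set ps. visited N [p] - {0})" for ps
    by (auto simp: visited_def)
  have cap: "2 * card (visited N [p] - {0}) \<le> length p" if "p \<in> set (fst F) \<union> set (snd F)" for p
    using tour_visits_at_most tour[OF that] by (simp add: N_def)
  have "card (visited N [p] - {0}) \<le> nat \<lfloor>B\<rfloor>" if "p \<in> set (fst F)" for p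
    using cap[of p] time(1)[OF that] that
    by (simp add: N_def truck_time_star le_nat_floor)
  then show "card (visited N (fst F) - {0}) \<le> m * nat \<lfloor>B\<rfloor>"
    unfolding eq[of "fst F"] len(1)[symmetric] by (rule card_UN_list_le)
  have "card (visited N [p] - {0}) \<le> nat \<lfloor>\<alpha> * B\<rfloor>" if "p \<in> set (snd F)" for p
    using cap[of p] time(2)[OF that] that \<alpha>
    by (simp add: N_def drone_time_star le_nat_floor field_simps)
  then show "card (visited N (snd F) - {0}) \<le> h * nat \<lfloor>\<alpha> * B\<rfloor>"
    unfolding eq[of "snd F"] len(2)[symmetric] by (rule card_UN_list_le)
qed

section \<open>Families that attain the capacity bounds\<close>

definition star_tour :: "nat list \<Rightarrow> nat tour" where
  "star_tour vs = concat (map (\<lambda>v. [(0, v), (v, 0)]) vs)"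

text \<open>The tour makes one round trip per list entry; if no entry repeats, it attains the bound
  of \<open>tour_visits_at_most\<close>.\<close>

lemma star_tour:
  assumes "set vs \<subseteq> {1..n}"
  shows "is_tour (star_network k l \<alpha> n) (star_tour vs)"
    and "visited (star_network k l \<alpha> n) [star_tour vs] = insert 0 (set vs)"
    and "length (star_tour vs) = 2 * length vs"
  using assms
  by (induction vs) (auto simp: star_tour_def is_tour_def visited_def star.awalk_def)

text \<open>Greedy loading: the first vehicle takes as many elements as its capacity
  \<open>a\<close> allows, and the rest fits into the remaining ones.\<close>

lemma split_into_lists:
  assumes "finite X" "card X \<le> m * a"
  shows "\<exists>vss. length vss = m \<and> (\<forall>vs\<in>set vss. length vs \<le> a) \<and> \<Union> (set ` set vss) = X"
  using assms
proof (induction m arbitrary: X)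
  case (Suc m)
  obtain Y where Y: "Y \<subseteq> X" "card Y = min a (card X)"
    using obtain_subset_with_card_n[of "min a (card X)" X] by auto
  have "finite Y" using Y Suc.prems finite_subset by blast
  then obtain vs where vs: "set vs = Y" "length vs = card Y"
    using finite_distinct_list distinct_card by metis
  have "card (X - Y) \<le> m * a"
    using Suc.prems Y \<open>finite Y\<close> by (auto simp: card_Diff_subset)
  then obtain vss where vss: "length vss = m" "\<forall>vs\<in>set vss. length vs \<le> a" "\<Union> (set ` set vss) = X - Y"
    using Suc.IH[of "X - Y"] Suc.prems by auto
  show ?case
    using vs vss Y by (intro exI[of _ "vs # vss"]) auto
qed simp

text \<open>Converse of \<open>family_visits_at_most\<close>: respecting the capacities is also
  sufficient. The case \<open>h = 0\<close> serves the second stage, which has trucks only.\<close>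

lemma ex_star_family:
  fixes k l \<alpha> n
  defines "N \<equiv> star_network k l \<alpha> n"
  assumes X: "X \<subseteq> {1..n}" "card X \<le> m * nat \<lfloor>B\<rfloor>"
    and Y: "Y \<subseteq> {1..n}" "card Y \<le> h * nat \<lfloor>\<alpha> * B\<rfloor>"
    and mh: "1 \<le> m + h" and \<alpha>: "0 < \<alpha>" and B: "0 \<le> B"
  shows "\<exists>F\<in>families N m h. X \<subseteq> visited N (fst F) \<and> Y \<subseteq> visited N (snd F) \<and> makespan N F \<le> B"
proof -
  obtain vss where vss: "length vss = m" "\<forall>vs\<in>set vss. length vs \<le> nat \<lfloor>B\<rfloor>" "\<Union> (set ` set vss) = X"
    using split_into_lists[OF _ X(2)] finite_subset[OF X(1)] by auto
  obtain wss where wss: "length wss = h" "\<forall>vs\<in>set wss. length vs \<le> nat \<lfloor>\<alpha> * B\<rfloor>" "\<Union> (set ` set wss) = Y"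
    using split_into_lists[OF _ Y(2)] finite_subset[OF Y(1)] by auto
  let ?F = "(map star_tour vss, map star_tour wss)"
  have sub: "set vs \<subseteq> {1..n}" if "vs \<in> set vss \<union> set wss" for vs
    using that vss(3) wss(3) X(1) Y(1) by blast
  have "?F \<in> families N m h"
    using vss(1) wss(1) sub star_tour(1) by (auto simp: families_def N_def)
  moreover have cov: "\<Union> (set ` set us) \<subseteq> visited N (map star_tour us)" if "set us \<subseteq> set vss \<union> set wss" for us
  proof -
    have "set vs \<subseteq> visited N [star_tour vs]" if "vs \<in> set us" for vs
      using star_tour(2)[OF sub[of vs]] that \<open>set us \<subseteq> _\<close> by (auto simp: N_def)
    then show ?thesis by (fastforce simp: visited_def)
  qed
  moreover have "makespan N ?F \<le> B"
  proof -
    have "truck_time N (star_tour vs) \<le> B" if "vs \<in> set vss" for vs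
    proof -
      have "real (length vs) \<le> B" using vss(2) that B by (simp add: le_nat_iff le_floor_iff)
      then show ?thesis using star_tour(3)[OF sub[of vs]] that by (simp add: N_def truck_time_star)
    qed
    moreover have "drone_time N (star_tour vs) \<le> B" if "vs \<in> set wss" for vs
    proof -
      have "real (length vs) \<le> \<alpha> * B" using wss(2) that B \<alpha> by (simp add: le_nat_iff le_floor_iff)
      then show ?thesis
        using star_tour(3)[OF sub[of vs]] that \<alpha> by (simp add: N_def drone_time_star field_simps)
    qed
    ultimately show ?thesis
      using mh vss(1) wss(1) by (subst makespan_le_iff) auto
  qed
  ultimately show ?thesis using cov[of vss] cov[of wss] vss(3) wss(3) by (intro bexI[of _ ?F]) auto
qed

section \<open>Both stages and the full-information optimum on the star\<close>

theorem lemma18: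
  fixes \<alpha> :: real and k\<^sub>t k\<^sub>d :: nat and S :: "nat network \<Rightarrow> nat family"
  assumes "\<alpha> > 0" and "\<alpha> \<noteq> 1" and "k\<^sub>t \<ge> 1" and "k\<^sub>d \<ge> 1"
    and "first_stage_rule S"
  shows "\<exists>N D. rdp_instance N D \<and> trucks N = k\<^sub>t \<and> drones N = k\<^sub>d \<and> speed N = \<alpha> \<and>
           Optimistic S N D / OPT N D = min 2 (1 + \<alpha>)"
proof -
  define M where "M = max 1 (1 / \<alpha>)"
  \<comment> \<open>\<open>a\<close> and \<open>b\<close> are what one truck and one drone can serve
    in time \<open>M\<close>; the slower kind has capacity exactly 1.\<close>
  define a where "a = nat \<lfloor>M\<rfloor>"
  define b where "b = nat \<lfloor>\<alpha> * M\<rfloor>"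
  define n where "n = k\<^sub>t * a + k\<^sub>d * b"
  define N where "N = star_network k\<^sub>t k\<^sub>d \<alpha> n"
  have M: "1 \<le> M" "1 \<le> \<alpha> * M" "M = 1 \<or> \<alpha> * M = 1"
    using \<open>\<alpha> > 0\<close> by (auto simp: M_def max_def field_simps)
  then have ab: "1 \<le> a" "1 \<le> b" by (simp_all add: a_def b_def le_nat_iff le_floor_iff)
  have ka: "1 \<le> k\<^sub>t * a" and kb: "1 \<le> k\<^sub>d * b" using ab \<open>k\<^sub>t \<ge> 1\<close> \<open>k\<^sub>d \<ge> 1\<close> by simp_all
  then have "1 \<le> n" unfolding n_def by linarith
  then have N: "rdp_network N"
    using rdp_network_star assms by (simp add: N_def)
  have sel [simp]: "trucks N = k\<^sub>t" "drones N = k\<^sub>d" "customers N = {1..n}" by (simp_all add: N_def)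
  note cap = family_visits_at_most[of _ k\<^sub>t k\<^sub>d \<alpha> n, folded N_def]
  note build = ex_star_family[of _ n _ _ _ _ \<alpha> k\<^sub>t k\<^sub>d, folded N_def]

  have lower: "M \<le> makespan N F" if F: "F \<in> covering N k\<^sub>t k\<^sub>d {1..n}" for F
  proof (rule ccontr)
    assume less: "\<not> M \<le> makespan N F"
    define B where "B = makespan N F"
    have "B < M" using less by (simp add: B_def)
    \<comment> \<open>Whichever kind needs all of \<open>M\<close> for one customer cannot serve any
      in time \<open>B\<close>.\<close>
    then have "B < 1 \<or> \<alpha> * B < 1"
      using M(3) \<open>\<alpha> > 0\<close> by (metis mult_strict_left_mono)
    then have strict: "nat \<lfloor>B\<rfloor> < a \<or> nat \<lfloor>\<alpha> * B\<rfloor> < b" using ab by linarith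
    have mono: "nat \<lfloor>B\<rfloor> \<le> a" "nat \<lfloor>\<alpha> * B\<rfloor> \<le> b"
      using \<open>B < M\<close> \<open>\<alpha> > 0\<close> by (auto simp: a_def b_def intro!: nat_mono floor_mono)
    have fam: "F \<in> families N k\<^sub>t k\<^sub>d" and cov: "{1..n} \<subseteq> visited N (fst F) \<union> visited N (snd F)"
      using F by (auto simp: covering_def)
    have fin: "finite (visited N ps)" for ps by (simp add: visited_def)
    have "{1..n} \<subseteq> (visited N (fst F) - {0}) \<union> (visited N (snd F) - {0})" using cov by auto
    then have "card {1..n} \<le> card ((visited N (fst F) - {0}) \<union> (visited N (snd F) - {0}))"
      using fin by (intro card_mono) auto
    also have "\<dots> \<le> card (visited N (fst F) - {0}) + card (visited N (snd F) - {0})"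
      by (rule card_Un_le)
    also have "\<dots> \<le> k\<^sub>t * nat \<lfloor>B\<rfloor> + k\<^sub>d * nat \<lfloor>\<alpha> * B\<rfloor>"
      using cap[OF fam, of B] assms by (intro add_mono) (simp_all add: B_def)
    \<comment> \<open>One kind loses capacity, the other gains none, and there is at least one
      vehicle of each kind.\<close>
    also have "\<dots> < n"
      using strict
    proof
      assume "nat \<lfloor>B\<rfloor> < a"
      then show ?thesis unfolding n_def
        using mono(2) \<open>k\<^sub>t \<ge> 1\<close> by (intro add_less_le_mono) auto
    next
      assume "nat \<lfloor>\<alpha> * B\<rfloor> < b"
      then show ?thesis unfolding n_def
        using mono(1) \<open>k\<^sub>d \<ge> 1\<close> by (intro add_le_less_mono) auto
    qed
    finally show False by simp
  qed

  have upper: "\<exists>F\<in>full_information N {d}. makespan N F \<le> M" if d: "d \<in> {1..n}" for d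
  proof -
    \<comment> \<open>\<open>X\<close> is a full load for the trucks that contains \<open>d\<close>;
      what remains is exactly a full load for the drones.\<close>
    obtain X where X: "{d} \<subseteq> X" "X \<subseteq> {1..n}" "card X = k\<^sub>t * a"
      using exists_subset_between[of "{d}" "k\<^sub>t * a" "{1..n}"] ka d by (auto simp: n_def)
    have "card ({1..n} - X) = k\<^sub>d * b"
      using X finite_subset[OF X(2)] by (simp add: card_Diff_subset n_def)
    then obtain F where "F \<in> families N k\<^sub>t k\<^sub>d" "X \<subseteq> visited N (fst F)"
      "{1..n} - X \<subseteq> visited N (snd F)" "makespan N F \<le> M"
      using build[OF X(2) _ Diff_subset, of k\<^sub>t M X k\<^sub>d] X(3) M(1) assms by (auto simp: a_def b_def)
    then show ?thesis using X(1) by (intro bexI[of _ F]) (auto simp: full_information_def)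
  qed
  \<comment> \<open>Transfers \<open>lower\<close> to the full-information optimum and
    \<open>upper\<close> to the first stage.\<close>
  have full_covering: "full_information N D \<subseteq> covering N k\<^sub>t k\<^sub>d {1..n}" for D
    by (auto simp: full_information_def covering_def)

  have S: "optimal_family N k\<^sub>t k\<^sub>d {1..n} (S N)"
    using assms(5) N unfolding first_stage_rule_def by fastforce
  then have SN: "S N \<in> covering N k\<^sub>t k\<^sub>d {1..n}"
    "\<And>F. F \<in> covering N k\<^sub>t k\<^sub>d {1..n} \<Longrightarrow> makespan N (S N) \<le> makespan N F"
    unfolding optimal_family_def is_arg_min_linorder by blast+
  \<comment> \<open>Customer 1 is an arbitrary choice: only some covering family of makespan at most
    \<open>M\<close> is wanted.\<close>
  obtain F\<^sub>1 where "F\<^sub>1 \<in> full_information N {1}" "makespan N F\<^sub>1 \<le> M" using upper[of 1] \<open>1 \<le> n\<close> by auto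
  then have "makespan N (S N) \<le> M" using SN(2)[of F\<^sub>1] full_covering by force
  then have mk: "makespan N (S N) = M" using lower[OF SN(1)] by simp
  then have TSP: "TSP N k\<^sub>t k\<^sub>d {1..n} = M" using TSP_attained[OF S] by simp

  \<comment> \<open>The rule sees only \<open>N\<close>, so the damaged customer may be chosen after
    \<open>S N\<close>. The trucks serve at most \<open>k\<^sub>t * a\<close> customers, and the
    drones' share \<open>k\<^sub>d * b\<close> of \<open>n\<close> is at least 1.\<close>
  have "card (visited N (fst (S N)) - {0}) \<le> k\<^sub>t * a"
    using cap(1)[of "S N" k\<^sub>t k\<^sub>d M] SN(1) mk assms by (simp add: covering_def a_def)
  also have "\<dots> < card {1..n}" using kb by (simp add: n_def)
  finally have "\<not> {1..n} \<subseteq> visited N (fst (S N)) - {0}"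
    using card_mono[of "visited N (fst (S N)) - {0}" "{1..n}"] by (auto simp: visited_def)
  then obtain d where d: "d \<in> {1..n}" "d \<notin> visited N (fst (S N))" by fastforce
  then have I: "rdp_instance N {d}" using N by (simp add: rdp_instance_def)

  obtain F\<^sub>2 where F\<^sub>2: "is_arg_min (makespan N) (\<lambda>F. F \<in> full_information N {d}) F\<^sub>2"
    "OPT N {d} = makespan N F\<^sub>2"
    using OPT_attained[OF I] by blast
  then have "makespan N F\<^sub>2 \<le> M" using upper[OF d(1)] by (force simp: is_arg_min_linorder)
  moreover have "M \<le> makespan N F\<^sub>2"
    using F\<^sub>2(1) full_covering by (intro lower) (auto simp: is_arg_min_linorder)
  ultimately have OPT: "OPT N {d} = M" using F\<^sub>2(2) by simp

  \<comment> \<open>A minimiser turns the infimum \<open>TSP\<close> into a makespan, which is then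
    bounded from both sides by 1.\<close>
  obtain F\<^sub>3 where F\<^sub>3: "optimal_family N k\<^sub>t 0 {d} F\<^sub>3"
    using ex_optimal_family[OF N, of "{d}" k\<^sub>t 0] d(1) \<open>k\<^sub>t \<ge> 1\<close> by auto
  then have cov: "F\<^sub>3 \<in> covering N k\<^sub>t 0 {d}"
    and min: "\<And>F. F \<in> covering N k\<^sub>t 0 {d} \<Longrightarrow> makespan N F\<^sub>3 \<le> makespan N F"
    by (auto simp: optimal_family_def is_arg_min_linorder)
  \<comment> \<open>With time bound 1 every truck has capacity 1, which suffices for the single
    customer \<open>d\<close>.\<close>
  have "card {d} \<le> k\<^sub>t * nat \<lfloor>1 :: real\<rfloor>" using \<open>k\<^sub>t \<ge> 1\<close> by simp
  then obtain F where "F \<in> families N k\<^sub>t 0" "{d} \<subseteq> visited N (fst F)" "makespan N F \<le> 1"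
    using build[of "{d}" k\<^sub>t 1 "{}" 0] d(1) assms by auto
  then have "makespan N F\<^sub>3 \<le> 1" using min[of F] by (force simp: covering_def)
  moreover have "1 \<le> makespan N F\<^sub>3"
  proof (rule ccontr)
    assume less: "\<not> 1 \<le> makespan N F\<^sub>3"
    have "F\<^sub>3 \<in> families N k\<^sub>t 0" using cov by (simp add: covering_def)
    \<comment> \<open>Below time 1 the rounded-down capacity of each truck is 0.\<close>
    from cap(1)[OF this order_refl] have "card (visited N (fst F\<^sub>3) - {0}) \<le> 0"
      using less assms by simp
    then have "visited N (fst F\<^sub>3) - {0} = {}" by (simp add: visited_def)
    moreover have "visited N (snd F\<^sub>3) = {}" using cov by (auto simp: covering_def families_def visited_def)
    ultimately show False using cov d(1) by (auto simp: covering_def)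
  qed
  ultimately have "TSP N k\<^sub>t 0 {d} = 1" using TSP_attained[OF F\<^sub>3] by simp
  moreover have "missed_damaged S N {d} = {d}" using d(2) by (auto simp: missed_damaged_def)
  ultimately have "Optimistic S N {d} = M + 1" using TSP by (simp add: Optimistic_def)
  then have "Optimistic S N {d} / OPT N {d} = min 2 (1 + \<alpha>)"
    using OPT \<open>\<alpha> > 0\<close> by (auto simp: M_def max_def min_def field_simps)
  then show ?thesis
    using I by (intro exI[of _ N] exI[of _ "{d}"]) (simp add: N_def)
qed

end
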